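(* Let $B=1$, let $E$ be a real constant, and let $(\tau_{2n})_{n\ge0}$, $(s_{2n+1})_{n\ge0}$ be the sequences (depending on the prime $p$ and on $E$) defined in the context. Given that $\lim_{n\to\infty}\frac{\Gamma_p(2n+3)}{\Gamma_p(2n+5)}=\frac1{p^2}$, then for large primes $p$ (error terms understood, for each fixed $n$ and $E$, as $p\to\infty$ through the primes): $$\tau_{4n}=(-1)^n\frac{1}{p^{2n}}+O\!\left(\frac1{p^{2n+2}}\right)\quad\text{for } n\ge1,$$ $$\tau_{4n+2}=(-1)^n\frac{nE}{p^{2n+2}}+O\!\left(\frac1{p^{2n+4}}\right)\quad\text{for } n\ge2,$$ $$s_{4n+1}=(-1)^{n+1}p^{2n-2}+O(p^{2n-4})\quad\text{for } n\ge2,$$ $$s_{4n+3}=(-1)^{n+1}nE\,p^{2n-2}+O(p^{2n-4})\quad\text{for } n\ge2.$$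
   Context: For a real number $x\ne0$, $\Gamma_p(x)=\frac{1-p^{x-1}}{1-p^{-x}}$. Given constants $B\neq 0$, $E$, $c_0$, $k_5$, define $(c_n)_{n\ge0}$ and $(k_n)_{n\ge1}$ by: $c_2=0$, $c_{2n+1}=0$ for all $n\ge 0$, and $$c_{2n+4}\frac{\Gamma_p(2n+5)}{\Gamma_p(2n+3)}+Bc_{2n}=Ec_{2n+2}\quad(n\ge 0);$$ $k_1=k_3=0$, $k_{2n}=0$ for all $n\ge 1$, and $$k_{2n+1}\frac{\Gamma_p(-2n)}{\Gamma_p(-2n-2)}+Bk_{2n+5}=Ek_{2n+3}\quad(n\ge 1).$$ These depend linearly on $c_0$ and $k_5$ respectively, and $\tau_{2n}$, $s_{2n+1}$ are the coefficients with $c_{2n}=c_0\tau_{2n}$ and $k_{2n+1}=k_5s_{2n+1}$ for all $n\ge0$ (i.e. the values of $c_{2n}$ for $c_0=1$ and of $k_{2n+1}$ for $k_5=1$); so $\tau_0=1$, $\tau_2=0$, $s_1=s_3=0$, $s_5=1$. *)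

theory Defs
  imports Complex_Main "HOL-Library.Landau_Symbols" "HOL-Computational_Algebra.Primes"
begin

text \<open>Meant for \<open>x \<noteq> 0\<close>; at \<open>x = 0\<close> the denominator vanishes.\<close>

definition Gamma_p :: "nat \<Rightarrow> real \<Rightarrow> real" where
  "Gamma_p p x = (1 - real p powr (x - 1)) / (1 - real p powr (- x))"

definition is_c_seq :: "nat \<Rightarrow> real \<Rightarrow> real \<Rightarrow> real \<Rightarrow> (nat \<Rightarrow> real) \<Rightarrow> bool" where
  "is_c_seq p B E c0 c \<longleftrightarrow>
     c 0 = c0 \<and> c 2 = 0 \<and> (\<forall>n. c (2 * n + 1) = 0) \<and>
     (\<forall>n. c (2 * n + 4) * (Gamma_p p (2 * real n + 5) / Gamma_p p (2 * real n + 3))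
            + B * c (2 * n) = E * c (2 * n + 2))"

text \<open>The sequence \<open>k\<close> starts at index 1; the value \<open>k 0\<close> is irrelevant.\<close>

definition is_k_seq :: "nat \<Rightarrow> real \<Rightarrow> real \<Rightarrow> real \<Rightarrow> (nat \<Rightarrow> real) \<Rightarrow> bool" where
  "is_k_seq p B E k5 k \<longleftrightarrow>
     k 5 = k5 \<and> k 1 = 0 \<and> k 3 = 0 \<and> (\<forall>n\<ge>1. k (2 * n) = 0) \<and>
     (\<forall>n\<ge>1. k (2 * n + 1) * (Gamma_p p (- 2 * real n) / Gamma_p p (- 2 * real n - 2))
            + B * k (2 * n + 5) = E * k (2 * n + 3))"

text \<open>Only the even-indexed values of \<open>\<tau>\<close> and the odd-indexed values of \<open>s\<close> are constrained.\<close>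

definition tau_coeffs :: "nat \<Rightarrow> real \<Rightarrow> real \<Rightarrow> (nat \<Rightarrow> real) \<Rightarrow> bool" where
  "tau_coeffs p B E \<tau> \<longleftrightarrow>
     (\<forall>c0 c. is_c_seq p B E c0 c \<longrightarrow> (\<forall>n. c (2 * n) = c0 * \<tau> (2 * n)))"

definition s_coeffs :: "nat \<Rightarrow> real \<Rightarrow> real \<Rightarrow> (nat \<Rightarrow> real) \<Rightarrow> bool" where
  "s_coeffs p B E s \<longleftrightarrow>
     (\<forall>k5 k. is_k_seq p B E k5 k \<longrightarrow> (\<forall>n. k (2 * n + 1) = k5 * s (2 * n + 1)))"

abbreviation primes_at_top :: "nat filter" where
  "primes_at_top \<equiv> inf at_top (principal {p. prime p})"

end

theory Submission imports Defs
begin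

text \<open>
  Write \<open>h = p\<^sup>-\<^sup>2\<close> and \<open>r\<^sub>n = \<Gamma>\<^sub>p(2n+3) / \<Gamma>\<^sub>p(2n+5)\<close>. Pulling the dominant power of \<open>p\<close> out of every
  factor of \<open>r\<^sub>n\<close> shows \<open>r\<^sub>n = h (1 + O(h))\<close> for fixed \<open>n\<close> as \<open>p \<rightarrow> \<infinity>\<close>, and the reflection formula
  \<open>\<Gamma>\<^sub>p(1-x) = 1/\<Gamma>\<^sub>p(x)\<close> identifies the ratio in the recursion for \<open>k\<close> with \<open>1/r\<^sub>n\<^sub>-\<^sub>1\<close>. So the
  coefficients satisfy
  \<open>\<tau>\<^sub>2\<^sub>n\<^sub>+\<^sub>4 = r\<^sub>n (E \<tau>\<^sub>2\<^sub>n\<^sub>+\<^sub>2 - \<tau>\<^sub>2\<^sub>n)\<close> and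
  \<open>s\<^sub>2\<^sub>n\<^sub>+\<^sub>7 = E s\<^sub>2\<^sub>n\<^sub>+\<^sub>5 - s\<^sub>2\<^sub>n\<^sub>+\<^sub>3 / r\<^sub>n\<close>.

  Two steps of either recursion change the order of magnitude by a factor \<open>p\<^sup>2\<close>: \<open>\<tau>\<close> loses it and \<open>s\<close>
  gains it. Dividing these powers out, put
  \<open>a\<^sub>n = p\<^sup>2\<^sup>n \<tau>\<^sub>4\<^sub>n\<close>, \<open>b\<^sub>n = p\<^sup>2\<^sup>n\<^sup>+\<^sup>2 \<tau>\<^sub>4\<^sub>n\<^sub>+\<^sub>2\<close>
  in the first case and
  \<open>a\<^sub>n = s\<^sub>4\<^sub>n\<^sub>+\<^sub>5 / p\<^sup>2\<^sup>n\<close>, \<open>b\<^sub>n = s\<^sub>4\<^sub>n\<^sub>+\<^sub>7 / p\<^sup>2\<^sup>n\<close>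
  in the second. Either way
  \<open>a\<^sub>n\<^sub>+\<^sub>1 = \<alpha> h E b\<^sub>n - \<beta> a\<^sub>n\<close> and
  \<open>b\<^sub>n\<^sub>+\<^sub>1 = \<gamma> E a\<^sub>n\<^sub>+\<^sub>1 - \<delta> b\<^sub>n\<close>
  with factors \<open>\<alpha>, \<beta>, \<gamma>, \<delta>\<close> of the form \<open>1 + O(h)\<close>, and \<open>a\<^sub>0 = 1\<close>, \<open>b\<^sub>0 = e E\<close>, where \<open>e = 0\<close> for \<open>\<tau>\<close>
  and \<open>e = 1\<close> for \<open>s\<close>. A single induction (\<open>perturbed_alternating_recursion\<close>) gives
  \<open>a\<^sub>n = (-1)\<^sup>n + O(h)\<close> and \<open>b\<^sub>n = (-1)\<^sup>n (n+e) E + O(h)\<close>; undoing the normalisation yields all four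
  estimates.
\<close>

section \<open>Functions that are constant up to a vanishing error\<close>

lemma bigo_const_error_bounded:
  fixes f h :: "'a \<Rightarrow> real"
  assumes "(\<lambda>x. f x - c) \<in> O[F](h)" and "(h \<longlongrightarrow> 0) F"
  shows "f \<in> O[F](\<lambda>_. 1)"
proof -
  have "h \<in> O[F](\<lambda>_. 1)"
    using assms(2) by (intro landau_o.small_imp_big smalloI_tendsto) auto
  with assms(1) have "(\<lambda>x. f x - c) \<in> O[F](\<lambda>_. 1)"
    using landau_o.big_trans by blast
  moreover have "(\<lambda>_. c) \<in> O[F](\<lambda>_. 1)" by simp
  ultimately have "(\<lambda>x. (f x - c) + c) \<in> O[F](\<lambda>_. 1)"
    by (rule sum_in_bigo(1))
  then show ?thesis by (simp only: diff_add_cancel)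
qed

lemma bigo_const_error_mult:
  fixes f g h :: "'a \<Rightarrow> real"
  assumes f: "(\<lambda>x. f x - c) \<in> O[F](h)" and g: "(\<lambda>x. g x - d) \<in> O[F](h)"
    and h: "(h \<longlongrightarrow> 0) F"
  shows "(\<lambda>x. f x * g x - c * d) \<in> O[F](h)"
proof -
  have "(\<lambda>x. f x * (g x - d)) \<in> O[F](\<lambda>x. 1 * h x)"
    by (intro landau_o.big.mult bigo_const_error_bounded[OF f h] g)
  moreover have "(\<lambda>x. (f x - c) * d) \<in> O[F](\<lambda>x. h x * 1)"
    by (intro landau_o.big.mult f) auto
  ultimately have "(\<lambda>x. f x * (g x - d) + (f x - c) * d) \<in> O[F](h)"
    by (intro sum_in_bigo) auto
  then show ?thesis by (simp add: algebra_simps)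
qed

lemma bigo_const_error_inverse:
  fixes f h :: "'a \<Rightarrow> real"
  assumes f: "(\<lambda>x. f x - 1) \<in> O[F](h)" and h: "(h \<longlongrightarrow> 0) F"
  shows "(\<lambda>x. inverse (f x) - 1) \<in> O[F](h)"
proof -
  have "h \<in> o[F](\<lambda>_. 1)" using h by (intro smalloI_tendsto) auto
  then have "(\<lambda>x. f x - 1) \<in> o[F](\<lambda>_. 1)"
    using f landau_o.big_small_trans by blast
  then have "((\<lambda>x. f x - 1) \<longlongrightarrow> 0) F" by (auto dest: smalloD_tendsto)
  then have lim: "(f \<longlongrightarrow> 1) F" by (simp only: LIM_zero_iff)
  then have "((\<lambda>x. inverse (f x)) \<longlongrightarrow> inverse 1) F" by (intro tendsto_inverse) auto
  then have "(\<lambda>x. inverse (f x)) \<in> O[F](\<lambda>_. 1)"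
    by (intro bigoI_tendsto[where c = 1]) auto
  then have "(\<lambda>x. - (f x - 1) * inverse (f x)) \<in> O[F](\<lambda>x. h x * 1)"
    using f by (intro landau_o.big.mult) (simp only: landau_o.big.uminus_in_iff)
  moreover have "eventually (\<lambda>x. f x \<noteq> 0) F"
    using tendsto_imp_eventually_ne[OF lim, of 0] by simp
  then have "eventually (\<lambda>x. - (f x - 1) * inverse (f x) = inverse (f x) - 1) F"
    by eventually_elim (simp add: field_simps)
  ultimately show ?thesis using landau_o.big.in_cong by fastforce
qed

section \<open>The normalised recursion\<close>

text \<open>
  The common form of the two recursions after normalisation.
  Letting the error \<open>h\<close> tend to \<open>0\<close> turns the recursion into \<open>a\<^sub>n\<^sub>+\<^sub>1 = - a\<^sub>n\<close>,
  \<open>b\<^sub>n\<^sub>+\<^sub>1 = E a\<^sub>n\<^sub>+\<^sub>1 - b\<^sub>n\<close>: the first sequence alternates, and the second collects one more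
  copy of \<open>E\<close>, up to the alternating sign, at each step. All steps preserve an error \<open>O(h)\<close>, since each
  \<open>a\<^sub>n\<close> and \<open>b\<^sub>n\<close> stays bounded along \<open>F\<close>.
\<close>

lemma perturbed_alternating_recursion:
  fixes a b \<alpha> \<beta> \<gamma> \<delta> :: "nat \<Rightarrow> 'a \<Rightarrow> real" and h :: "'a \<Rightarrow> real" and E e :: real
  assumes h: "(h \<longlongrightarrow> 0) F"
    and coeffs: "\<And>n. (\<lambda>x. \<alpha> n x - 1) \<in> O[F](h)" "\<And>n. (\<lambda>x. \<beta> n x - 1) \<in> O[F](h)"
      "\<And>n. (\<lambda>x. \<gamma> n x - 1) \<in> O[F](h)" "\<And>n. (\<lambda>x. \<delta> n x - 1) \<in> O[F](h)"
    and a0: "eventually (\<lambda>x. a 0 x = 1) F" and b0: "eventually (\<lambda>x. b 0 x = e * E) F"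
    and a_Suc: "\<And>n. eventually (\<lambda>x. a (Suc n) x = \<alpha> n x * (E * (h x * b n x)) - \<beta> n x * a n x) F"
    and b_Suc: "\<And>n. eventually (\<lambda>x. b (Suc n) x = \<gamma> n x * (E * a (Suc n) x) - \<delta> n x * b n x) F"
  shows "(\<lambda>x. a n x - (-1) ^ n) \<in> O[F](h) \<and>
         (\<lambda>x. b n x - (-1) ^ n * ((real n + e) * E)) \<in> O[F](h)"
proof (induction n)
  case 0
  have "eventually (\<lambda>x. a 0 x - 1 = 0) F" "eventually (\<lambda>x. b 0 x - e * E = 0) F"
    using a0 b0 by (auto elim: eventually_mono)
  from this[THEN landau_o.big.in_cong] show ?case by simp
next
  case (Suc n)
  let ?A = "\<lambda>x. \<alpha> n x * (E * (h x * b n x)) - \<beta> n x * a n x"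
  let ?B = "\<lambda>x. \<gamma> n x * (E * a (Suc n) x) - \<delta> n x * b n x"
  note IH = conjunct1[OF Suc.IH] conjunct2[OF Suc.IH]
  have const: "(\<lambda>x. E - E) \<in> O[F](h)" by simp
  have "(\<lambda>x. h x - 0) \<in> O[F](h)" by simp
  then have "(\<lambda>x. h x * b n x - 0 * ((-1) ^ n * ((real n + e) * E))) \<in> O[F](h)"
    by (intro bigo_const_error_mult IH h)
  then have "(\<lambda>x. \<alpha> n x * (E * (h x * b n x)) - 1 * (E * 0)) \<in> O[F](h)"
    by (intro bigo_const_error_mult coeffs const h) simp
  moreover have "(\<lambda>x. \<beta> n x * a n x - 1 * (-1) ^ n) \<in> O[F](h)"
    by (intro bigo_const_error_mult coeffs IH h)
  ultimately have "(\<lambda>x. (\<alpha> n x * (E * (h x * b n x)) - 1 * (E * 0))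
                     - (\<beta> n x * a n x - 1 * (-1) ^ n)) \<in> O[F](h)"
    by (rule sum_in_bigo(2))
  then have "(\<lambda>x. ?A x - (-1) ^ Suc n) \<in> O[F](h)" by (simp add: algebra_simps)
  moreover have "eventually (\<lambda>x. a (Suc n) x - (-1) ^ Suc n = ?A x - (-1) ^ Suc n) F"
    using a_Suc[of n] by eventually_elim simp
  ultimately have a: "(\<lambda>x. a (Suc n) x - (-1) ^ Suc n) \<in> O[F](h)"
    using landau_o.big.in_cong by fast
  have "(\<lambda>x. \<gamma> n x * (E * a (Suc n) x) - 1 * (E * (-1) ^ Suc n)) \<in> O[F](h)"
    by (intro bigo_const_error_mult coeffs const a h)
  moreover have "(\<lambda>x. \<delta> n x * b n x - 1 * ((-1) ^ n * ((real n + e) * E))) \<in> O[F](h)"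
    by (intro bigo_const_error_mult coeffs IH h)
  ultimately have "(\<lambda>x. (\<gamma> n x * (E * a (Suc n) x) - 1 * (E * (-1) ^ Suc n))
      - (\<delta> n x * b n x - 1 * ((-1) ^ n * ((real n + e) * E)))) \<in> O[F](h)"
    by (rule sum_in_bigo(2))
  then have "(\<lambda>x. ?B x - (-1) ^ Suc n * ((real (Suc n) + e) * E)) \<in> O[F](h)"
    by (simp add: algebra_simps)
  moreover have "eventually (\<lambda>x. b (Suc n) x - (-1) ^ Suc n * ((real (Suc n) + e) * E)
      = ?B x - (-1) ^ Suc n * ((real (Suc n) + e) * E)) F"
    using b_Suc[of n] by eventually_elim simp
  ultimately show ?case using a landau_o.big.in_cong by fast
qed

section \<open>Ratios of gamma factors\<close>

definition Gamma_ratio :: "nat \<Rightarrow> nat \<Rightarrow> real" where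
  "Gamma_ratio p n = Gamma_p p (2 * real n + 3) / Gamma_p p (2 * real n + 5)"

text \<open>
  The reflection formula turns the ratios at negative arguments, which govern the
  recursion for \<open>k\<close>, into the inverses of those that govern the recursion for \<open>c\<close>.
\<close>

lemma Gamma_p_reflection: "Gamma_p p (1 - x) = inverse (Gamma_p p x)"
  by (simp add: Gamma_p_def)

lemma Gamma_ratio_negative:
  "Gamma_p p (- 2 * real (Suc n)) / Gamma_p p (- 2 * real (Suc n) - 2) = inverse (Gamma_ratio p n)"
proof -
  have "Gamma_p p (- 2 * real (Suc n)) = inverse (Gamma_p p (2 * real n + 3))"
    using Gamma_p_reflection[of p "2 * real n + 3"] by simp
  moreover have "Gamma_p p (- 2 * real (Suc n) - 2) = inverse (Gamma_p p (2 * real n + 5))"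
    using Gamma_p_reflection[of p "2 * real n + 5"] by simp
  ultimately show ?thesis by (simp add: Gamma_ratio_def field_simps)
qed

lemma Gamma_p_odd:
  assumes "p > 1"
  shows "Gamma_p p (real (2 * m + 1))
    = - (real p ^ (2 * m)) * (1 - 1 / real p ^ (2 * m)) / (1 - 1 / real p ^ (2 * m + 1))"
proof -
  have "real p powr (real (2 * m + 1) - 1) = real p ^ (2 * m)"
    using powr_realpow[of "real p" "2 * m"] assms by simp
  moreover have "real p powr - real (2 * m + 1) = 1 / real p ^ (2 * m + 1)"
    using powr_realpow[of "real p" "2 * m + 1"] assms by (simp only: powr_minus_divide)
  moreover have "1 - real p ^ (2 * m) = - (real p ^ (2 * m)) * (1 - 1 / real p ^ (2 * m))"
    using assms by (simp add: right_diff_distrib)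
  ultimately show ?thesis by (simp only: Gamma_p_def)
qed

lemma Gamma_p_odd_nonzero:
  assumes "p > 1" "m > 0"
  shows "Gamma_p p (real (2 * m + 1)) \<noteq> 0"
proof -
  have "real p ^ (2 * m) > 1" "real p ^ (2 * m + 1) > 1"
    using assms by (auto intro!: one_less_power simp del: power_Suc)
  moreover have "1 - 1 / x \<noteq> 0" if "x > 1" for x :: real
    using that by (simp add: field_simps)
  ultimately have "1 - 1 / real p ^ (2 * m) \<noteq> 0" "1 - 1 / real p ^ (2 * m + 1) \<noteq> 0"
    by blast+
  moreover have "real p ^ (2 * m) \<noteq> 0" using assms by simp
  ultimately show ?thesis using assms by (simp only: Gamma_p_odd) simp
qed

lemma Gamma_ratio_nonzero: "p > 1 \<Longrightarrow> Gamma_ratio p n \<noteq> 0"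
  using Gamma_p_odd_nonzero[of p "n + 1"] Gamma_p_odd_nonzero[of p "n + 2"]
  by (simp add: Gamma_ratio_def algebra_simps)

text \<open>
  Both gamma factors are dominated by the power of \<open>p\<close> in the numerator. Taking it out leaves
  factors \<open>1 - p\<^sup>-\<^sup>k\<close> with \<open>k \<ge> 2\<close> only, each of which is \<open>1 + O(p\<^sup>-\<^sup>2)\<close>.
\<close>

lemma Gamma_ratio_factorization:
  assumes "p > 1"
  shows "real p ^ 2 * Gamma_ratio p n =
    (1 - 1 / real p ^ (2 * n + 2)) * inverse (1 - 1 / real p ^ (2 * n + 3)) *
    ((1 - 1 / real p ^ (2 * n + 5)) * inverse (1 - 1 / real p ^ (2 * n + 4)))"
proof -
  have *: "2 * real n + 3 = real (2 * (n + 1) + 1)" "2 * real n + 5 = real (2 * (n + 2) + 1)"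
    by simp_all
  have e: "2 * (n + 1) = 2 * n + 2" "2 * (n + 2) = 2 * n + 4" 
    "2 * n + 2 + 1 = 2 * n + 3" "2 * n + 4 + 1 = 2 * n + 5" by simp_all
  have pw: "real p ^ (2 * n + 4) = real p ^ 2 * real p ^ (2 * n + 2)"
    by (simp add: power_add power2_eq_square eval_nat_numeral)
  have cancel: "real p ^ 2 * (P * A / B / (real p ^ 2 * P * C / D))
      = A * inverse B * (D * inverse C)" if "P \<noteq> 0" for P A B C D :: real
    using assms that by (simp add: field_simps)
  have odd3: "Gamma_p p (2 * real n + 3) =
      - (real p ^ (2 * n + 2)) * (1 - 1 / real p ^ (2 * n + 2)) / (1 - 1 / real p ^ (2 * n + 3))"
    unfolding *(1) unfolding Gamma_p_odd[OF assms] unfolding e by (rule refl)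
  have odd5: "Gamma_p p (2 * real n + 5) =
      real p ^ 2 * - (real p ^ (2 * n + 2)) * (1 - 1 / real p ^ (2 * n + 4))
        / (1 - 1 / real p ^ (2 * n + 5))"
    unfolding *(2) unfolding Gamma_p_odd[OF assms] unfolding e unfolding pw by simp
  show ?thesis
    unfolding Gamma_ratio_def odd3 odd5 by (rule cancel) (use assms in simp)
qed

lemma tendsto_inverse_square_primes: "((\<lambda>p. 1 / real p ^ 2) \<longlongrightarrow> 0) primes_at_top"
proof -
  have "((\<lambda>p. 1 / real p ^ 2) \<longlongrightarrow> 0) at_top"
    by (intro tendsto_divide_0[OF tendsto_const] filterlim_at_top_imp_at_infinity
        filterlim_pow_at_top filterlim_real_sequentially) simp
  then show ?thesis by (rule tendsto_mono[rotated]) simp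
qed

lemma eventually_primes_gt_1: "eventually (\<lambda>p::nat. prime p \<and> p > 1) primes_at_top"
  by (auto simp: eventually_inf_principal intro!: always_eventually dest: prime_gt_Suc_0_nat)

lemma one_minus_inverse_power_bigo:
  assumes "k \<ge> 2"
  shows "(\<lambda>p. (1 - 1 / real p ^ k) - 1) \<in> O[primes_at_top](\<lambda>p. 1 / real p ^ 2)"
proof (rule bigoI[where c = 1])
  show "eventually (\<lambda>p. norm ((1 - 1 / real p ^ k) - 1) \<le> 1 * norm (1 / real p ^ 2)) primes_at_top"
    using eventually_primes_gt_1
  proof eventually_elim
    case (elim p)
    then have "real p ^ 2 \<le> real p ^ k" using assms by (intro power_increasing) auto
    then show ?case using elim by (simp add: frac_le)
  qed
qed

lemma Gamma_ratio_bigo: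
  "(\<lambda>p. real p ^ 2 * Gamma_ratio p n - 1) \<in> O[primes_at_top](\<lambda>p. 1 / real p ^ 2)"
proof -
  have "(\<lambda>p. (1 - 1 / real p ^ (2 * n + 2)) * inverse (1 - 1 / real p ^ (2 * n + 3)) *
      ((1 - 1 / real p ^ (2 * n + 5)) * inverse (1 - 1 / real p ^ (2 * n + 4))) - 1 * 1 * (1 * 1))
      \<in> O[primes_at_top](\<lambda>p. 1 / real p ^ 2)"
    by (intro bigo_const_error_mult bigo_const_error_inverse one_minus_inverse_power_bigo
          tendsto_inverse_square_primes) auto
  moreover have "eventually (\<lambda>p. real p ^ 2 * Gamma_ratio p n - 1 =
      (1 - 1 / real p ^ (2 * n + 2)) * inverse (1 - 1 / real p ^ (2 * n + 3)) *
      ((1 - 1 / real p ^ (2 * n + 5)) * inverse (1 - 1 / real p ^ (2 * n + 4))) - 1 * 1 * (1 * 1))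
      primes_at_top"
    using eventually_primes_gt_1 by eventually_elim (simp only: Gamma_ratio_factorization mult_1_left)
  ultimately show ?thesis using landau_o.big.in_cong by fast
qed

section \<open>Recursions for the coefficients\<close>

text \<open>
  The hypotheses on \<open>\<tau>\<close> and \<open>s\<close> only say that every solution of the respective recursion is a multiple
  of them. They determine the coefficients only once a solution with initial value \<open>1\<close> is known to
  exist, and this function supplies one.
\<close>

fun two_step_rec :: "'a \<Rightarrow> 'a \<Rightarrow> (nat \<Rightarrow> 'a \<Rightarrow> 'a \<Rightarrow> 'a) \<Rightarrow> nat \<Rightarrow> 'a" where
  "two_step_rec u v g 0 = u"
| "two_step_rec u v g (Suc 0) = v"
| "two_step_rec u v g (Suc (Suc n)) = g n (two_step_rec u v g n) (two_step_rec u v g (Suc n))"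

text \<open>
  The recursion determines \<open>c\<^sub>2\<^sub>n\<^sub>+\<^sub>4\<close> because the gamma ratio in front of it is nonzero.
\<close>

lemma tau_coeffs_recursion:
  assumes p: "p > 1" and tau: "tau_coeffs p B E \<tau>"
  shows "\<tau> 0 = 1" "\<tau> 2 = 0"
    "\<tau> (2 * n + 4) = Gamma_ratio p n * (E * \<tau> (2 * n + 2) - B * \<tau> (2 * n))"
proof -
  define f where "f = two_step_rec 1 0 (\<lambda>n x y. Gamma_ratio p n * (E * y - B * x))"
  define c where "c = (\<lambda>m. if even m then f (m div 2) else 0)"
  have c_rec: "c (2 * n + 4) = Gamma_ratio p n * (E * c (2 * n + 2) - B * c (2 * n))" for n
    by (simp add: c_def f_def)
  have "c (2 * n + 4) * (Gamma_p p (2 * real n + 5) / Gamma_p p (2 * real n + 3))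
            + B * c (2 * n) = E * c (2 * n + 2)" for n
  proof -
    have ratio: "Gamma_p p (2 * real n + 5) / Gamma_p p (2 * real n + 3) = inverse (Gamma_ratio p n)"
      by (simp add: Gamma_ratio_def)
    show ?thesis
      unfolding c_rec ratio using Gamma_ratio_nonzero[OF p, of n] by (simp add: field_simps)
  qed
  moreover have c01: "c 0 = 1" "c 2 = 0" by (simp_all add: c_def f_def)
  ultimately have "is_c_seq p B E 1 c" by (simp add: is_c_seq_def c_def)
  then have c_eq: "\<tau> (2 * n) = c (2 * n)" for n
    using tau unfolding tau_coeffs_def by (metis mult_1)
  show "\<tau> 0 = 1" "\<tau> 2 = 0" using c_eq[of 0] c_eq[of 1] c01 by simp_all
  show "\<tau> (2 * n + 4) = Gamma_ratio p n * (E * \<tau> (2 * n + 2) - B * \<tau> (2 * n))"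
  proof -
    have "2 * (n + 1) = 2 * n + 2" "2 * (n + 2) = 2 * n + 4" by simp_all
    then show ?thesis
      using c_rec[of n] c_eq[of n] c_eq[of "n + 1"] c_eq[of "n + 2"] by (simp only:)
  qed
qed

lemma s_coeffs_recursion:
  assumes s: "s_coeffs p 1 E s"
  shows "s 3 = 0" "s 5 = 1"
    "s (2 * n + 7) = E * s (2 * n + 5) - inverse (Gamma_ratio p n) * s (2 * n + 3)"
proof -
  \<comment> \<open>The index of \<open>f\<close> is shifted so that \<open>f 0\<close> and \<open>f 1\<close> are the prescribed values at \<open>3\<close> and \<open>5\<close>.\<close>
  define f where "f = two_step_rec 0 1 (\<lambda>n x y. E * y - inverse (Gamma_ratio p n) * x)"
  define k where "k = (\<lambda>m. if odd m \<and> m \<ge> 3 then f ((m - 3) div 2) else 0)"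
  have k_f: "k (2 * n + 3) = f n" for n
    by (simp add: k_def)
  have k_rec: "k (2 * n + 7) = E * k (2 * n + 5) - inverse (Gamma_ratio p n) * k (2 * n + 3)" for n
    using k_f[of n] k_f[of "Suc n"] k_f[of "Suc (Suc n)"] by (simp add: f_def eval_nat_numeral)
  have "k (2 * n + 1) * (Gamma_p p (- 2 * real n) / Gamma_p p (- 2 * real n - 2))
            + 1 * k (2 * n + 5) = E * k (2 * n + 3)" if n: "n \<ge> 1" for n
  proof -
    obtain m where m: "n = Suc m" using n by (cases n) auto
    have "2 * n + 1 = 2 * m + 3" "2 * n + 5 = 2 * m + 7" "2 * n + 3 = 2 * m + 5" using m by simp_all
    then show ?thesis using k_rec[of m] Gamma_ratio_negative[of p m] m by (simp only:) simp
  qed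
  moreover have k35: "k 3 = 0" "k 5 = 1"
    using k_f[of 0] k_f[of 1] by (simp_all add: f_def)
  moreover have "k 1 = 0" "\<forall>n\<ge>1. k (2 * n) = 0" by (simp_all add: k_def)
  ultimately have "is_k_seq p 1 E 1 k" unfolding is_k_seq_def by blast
  then have k_eq: "s (2 * n + 1) = k (2 * n + 1)" for n
    using s unfolding s_coeffs_def by (metis mult_1)
  show "s 3 = 0" "s 5 = 1" using k_eq[of 1] k_eq[of 2] k35 by simp_all
  show "s (2 * n + 7) = E * s (2 * n + 5) - inverse (Gamma_ratio p n) * s (2 * n + 3)"
  proof -
    have "2 * (n + 1) + 1 = 2 * n + 3" "2 * (n + 2) + 1 = 2 * n + 5" "2 * (n + 3) + 1 = 2 * n + 7"
      by simp_all
    then show ?thesis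
      using k_rec[of n] k_eq[of "n + 1"] k_eq[of "n + 2"] k_eq[of "n + 3"] by (simp only:)
  qed
qed

section \<open>Asymptotics of the coefficients\<close>

lemma tau_normalised:
  assumes tau: "\<And>p. prime p \<Longrightarrow> tau_coeffs p 1 E (\<tau> p)"
  shows "(\<lambda>p. real p ^ (2 * n) * \<tau> p (4 * n) - (-1) ^ n)
      \<in> O[primes_at_top](\<lambda>p. 1 / real p ^ 2) \<and>
    (\<lambda>p. real p ^ (2 * n + 2) * \<tau> p (4 * n + 2) - (-1) ^ n * ((real n + 0) * E))
      \<in> O[primes_at_top](\<lambda>p. 1 / real p ^ 2)"
proof (rule perturbed_alternating_recursion)
  let ?\<rho> = "\<lambda>n p. real p ^ 2 * Gamma_ratio p n"
  show "eventually (\<lambda>p. real p ^ (2 * 0) * \<tau> p (4 * 0) = 1) primes_at_top"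
    "eventually (\<lambda>p. real p ^ (2 * 0 + 2) * \<tau> p (4 * 0 + 2) = 0 * E) primes_at_top"
    using eventually_primes_gt_1
    by (eventually_elim; simp add: tau_coeffs_recursion(1,2)[OF _ tau] del: add_2_eq_Suc')+
  show "eventually (\<lambda>p. real p ^ (2 * Suc n) * \<tau> p (4 * Suc n)
      = ?\<rho> (2 * n) p * (E * (1 / real p ^ 2 * (real p ^ (2 * n + 2) * \<tau> p (4 * n + 2))))
        - ?\<rho> (2 * n) p * (real p ^ (2 * n) * \<tau> p (4 * n))) primes_at_top" for n
    using eventually_primes_gt_1
  proof eventually_elim
    case (elim p)
    then have "\<tau> p (4 * Suc n) = Gamma_ratio p (2 * n) * (E * \<tau> p (4 * n + 2) - \<tau> p (4 * n))"
      using tau_coeffs_recursion(3)[of p 1 E "\<tau> p" "2 * n"] tau[of p] by (simp add: add.commute)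
    moreover have "real p ^ (2 * Suc n) = real p ^ 2 * real p ^ (2 * n)"
      "real p ^ (2 * n + 2) = real p ^ 2 * real p ^ (2 * n)"
      "real p ^ (2 * Suc n + 2) = real p ^ 2 * (real p ^ 2 * real p ^ (2 * n))"
      by (simp_all add: power_add power2_eq_square)
    moreover have "real p ^ 2 \<noteq> 0" using elim by simp
    ultimately show ?case by (simp only:) (simp add: algebra_simps)
  qed
  show "eventually (\<lambda>p. real p ^ (2 * Suc n + 2) * \<tau> p (4 * Suc n + 2)
      = ?\<rho> (2 * n + 1) p * (E * (real p ^ (2 * Suc n) * \<tau> p (4 * Suc n)))
        - ?\<rho> (2 * n + 1) p * (real p ^ (2 * n + 2) * \<tau> p (4 * n + 2))) primes_at_top" for n
    using eventually_primes_gt_1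
  proof eventually_elim
    case (elim p)
    then have "\<tau> p (4 * Suc n + 2)
        = Gamma_ratio p (2 * n + 1) * (E * \<tau> p (4 * Suc n) - \<tau> p (4 * n + 2))"
    proof -
      have "2 * (2 * n + 1) + 4 = 4 * Suc n + 2" "2 * (2 * n + 1) + 2 = 4 * Suc n"
        "2 * (2 * n + 1) = 4 * n + 2" by simp_all
      then show ?thesis
        using tau_coeffs_recursion(3)[of p 1 E "\<tau> p" "2 * n + 1"] tau[of p] elim
        by (simp only: mult_1_left)
    qed
    moreover have "real p ^ (2 * Suc n) = real p ^ 2 * real p ^ (2 * n)"
      "real p ^ (2 * n + 2) = real p ^ 2 * real p ^ (2 * n)"
      "real p ^ (2 * Suc n + 2) = real p ^ 2 * (real p ^ 2 * real p ^ (2 * n))"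
      by (simp_all add: power_add power2_eq_square)
    moreover have "real p ^ 2 \<noteq> 0" using elim by simp
    ultimately show ?case by (simp only:) (simp add: algebra_simps)
  qed
qed (rule tendsto_inverse_square_primes Gamma_ratio_bigo)+

text \<open>
  Starting at the indices \<open>5\<close> and \<open>7\<close> makes the initial values \<open>1\<close> and \<open>E\<close> exact, and the first
  estimate that has an error term is then \<open>s\<^sub>9 = - p\<^sup>2 + O(1)\<close>.
\<close>

lemma s_normalised:
  assumes s: "\<And>p. prime p \<Longrightarrow> s_coeffs p 1 E (s p)"
  shows "(\<lambda>p. s p (4 * n + 5) / real p ^ (2 * n) - (-1) ^ n)
      \<in> O[primes_at_top](\<lambda>p. 1 / real p ^ 2) \<and>
    (\<lambda>p. s p (4 * n + 7) / real p ^ (2 * n) - (-1) ^ n * ((real n + 1) * E))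
      \<in> O[primes_at_top](\<lambda>p. 1 / real p ^ 2)"
proof (rule perturbed_alternating_recursion)
  let ?\<kappa> = "\<lambda>n p. inverse (real p ^ 2 * Gamma_ratio p n)"
  show "eventually (\<lambda>p. s p (4 * 0 + 5) / real p ^ (2 * 0) = 1) primes_at_top"
    "eventually (\<lambda>p. s p (4 * 0 + 7) / real p ^ (2 * 0) = 1 * E) primes_at_top"
    using eventually_primes_gt_1
    by (eventually_elim;
        simp add: s_coeffs_recursion(1,2)[OF s] s_coeffs_recursion(3)[OF s, where n = 0, simplified])+
  show "eventually (\<lambda>p. s p (4 * Suc n + 5) / real p ^ (2 * Suc n)
      = 1 * (E * (1 / real p ^ 2 * (s p (4 * n + 7) / real p ^ (2 * n))))
        - ?\<kappa> (2 * n + 1) p * (s p (4 * n + 5) / real p ^ (2 * n))) primes_at_top" for n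
    using eventually_primes_gt_1
  proof eventually_elim
    case (elim p)
    then have "s p (4 * Suc n + 5)
        = E * s p (4 * n + 7) - inverse (Gamma_ratio p (2 * n + 1)) * s p (4 * n + 5)"
      using s_coeffs_recursion(3)[of p E "s p" "2 * n + 1"] s[of p] by (simp add: add.commute)
    moreover have "real p ^ (2 * Suc n) = real p ^ 2 * real p ^ (2 * n)"
      by (simp add: power2_eq_square)
    ultimately show ?case
      by (simp only:) (simp add: diff_divide_distrib divide_inverse inverse_mult_distrib algebra_simps)
  qed
  show "eventually (\<lambda>p. s p (4 * Suc n + 7) / real p ^ (2 * Suc n)
      = 1 * (E * (s p (4 * Suc n + 5) / real p ^ (2 * Suc n)))
        - ?\<kappa> (2 * n + 2) p * (s p (4 * n + 7) / real p ^ (2 * n))) primes_at_top" for n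
    using eventually_primes_gt_1
  proof eventually_elim
    case (elim p)
    then have "s p (4 * Suc n + 7)
        = E * s p (4 * Suc n + 5) - inverse (Gamma_ratio p (2 * n + 2)) * s p (4 * n + 7)"
      using s_coeffs_recursion(3)[of p E "s p" "2 * n + 2"] s[of p] by (simp add: add.commute)
    moreover have "real p ^ (2 * Suc n) = real p ^ 2 * real p ^ (2 * n)"
      by (simp add: power2_eq_square)
    ultimately show ?case
      by (simp only:) (simp add: diff_divide_distrib divide_inverse inverse_mult_distrib algebra_simps)
  qed
  show "(\<lambda>p. 1 - 1) \<in> O[primes_at_top](\<lambda>p. 1 / real p ^ 2)"
    "(\<lambda>p. 1 - 1) \<in> O[primes_at_top](\<lambda>p. 1 / real p ^ 2)" by simp_all
qed (rule tendsto_inverse_square_primes bigo_const_error_inverse Gamma_ratio_bigo)+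

text \<open>Undoes a normalisation: \<open>g\<close> is the power of \<open>p\<close> that was divided out.\<close>

lemma bigo_primes_scale:
  assumes "(\<lambda>p. u p) \<in> O[primes_at_top](\<lambda>p. 1 / real p ^ 2)"
    and "\<And>p. p > 1 \<Longrightarrow> f p = g p * u p"
    and "\<And>p. p > 1 \<Longrightarrow> g p * (1 / real p ^ 2) = h p"
  shows "f \<in> O[primes_at_top](h)"
proof -
  have "(\<lambda>p. g p * u p) \<in> O[primes_at_top](\<lambda>p. g p * (1 / real p ^ 2))"
    by (intro landau_o.big.mult assms(1)) simp
  moreover have "eventually (\<lambda>p. f p = g p * u p) primes_at_top"
    using eventually_primes_gt_1 by eventually_elim (simp add: assms(2))
  moreover have "eventually (\<lambda>p. g p * (1 / real p ^ 2) = h p) primes_at_top"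
    using eventually_primes_gt_1 by eventually_elim (rule assms(3), simp)
  ultimately show ?thesis by (simp only: landau_o.big.in_cong landau_o.big.cong)
qed

theorem lemma2:
  fixes E :: real and \<tau> s :: "nat \<Rightarrow> nat \<Rightarrow> real"
  assumes tau: "\<And>p. prime p \<Longrightarrow> tau_coeffs p 1 E (\<tau> p)"
    and s: "\<And>p. prime p \<Longrightarrow> s_coeffs p 1 E (s p)"
    and lim: "\<And>p. prime p \<Longrightarrow>
      (\<lambda>n. Gamma_p p (2 * real n + 3) / Gamma_p p (2 * real n + 5)) \<longlonglongrightarrow> 1 / (real p)^2"
  shows "(\<forall>n\<ge>1. (\<lambda>p. \<tau> p (4 * n) - (-1)^n * (1 / real p ^ (2 * n)))
             \<in> O[primes_at_top](\<lambda>p. 1 / real p ^ (2 * n + 2)))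
       \<and> (\<forall>n\<ge>2. (\<lambda>p. \<tau> p (4 * n + 2) - (-1)^n * (real n * E / real p ^ (2 * n + 2)))
             \<in> O[primes_at_top](\<lambda>p. 1 / real p ^ (2 * n + 4)))
       \<and> (\<forall>n\<ge>2. (\<lambda>p. s p (4 * n + 1) - (-1)^(n + 1) * real p ^ (2 * n - 2))
             \<in> O[primes_at_top](\<lambda>p. real p ^ (2 * n - 4)))
       \<and> (\<forall>n\<ge>2. (\<lambda>p. s p (4 * n + 3) - (-1)^(n + 1) * real n * E * real p ^ (2 * n - 2))
             \<in> O[primes_at_top](\<lambda>p. real p ^ (2 * n - 4)))"
proof (intro conjI allI impI)
  fix n :: nat
  note T = tau_normalised[of E \<tau> n, OF tau]
  show "(\<lambda>p. \<tau> p (4 * n) - (-1)^n * (1 / real p ^ (2 * n)))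
      \<in> O[primes_at_top](\<lambda>p. 1 / real p ^ (2 * n + 2))"
    by (rule bigo_primes_scale[OF conjunct1[OF T], where g = "\<lambda>p. 1 / real p ^ (2 * n)"])
       (auto simp: field_simps power_add power2_eq_square)
  show "(\<lambda>p. \<tau> p (4 * n + 2) - (-1)^n * (real n * E / real p ^ (2 * n + 2)))
      \<in> O[primes_at_top](\<lambda>p. 1 / real p ^ (2 * n + 4))"
    by (rule bigo_primes_scale[OF conjunct2[OF T], where g = "\<lambda>p. 1 / real p ^ (2 * n + 2)"])
       (auto simp: field_simps power_add eval_nat_numeral)
next
  fix n :: nat
  assume "n \<ge> 2"
  \<comment> \<open>The normalised sequences for \<open>s\<close> start at \<open>n = 1\<close>. For \<open>m \<ge> 1\<close> the exponent \<open>2 * m - 2\<close> is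
    not truncated, so the factor \<open>p\<^sup>-\<^sup>2\<close> really lowers the power.\<close>
  then obtain m where n: "n = Suc m" and m: "m \<ge> 1" by (cases n) auto
  note S = s_normalised[of E s m, OF s]
  have eqs: "4 * n + 1 = 4 * m + 5" "4 * n + 3 = 4 * m + 7" "2 * n - 2 = 2 * m"
    "2 * n - 4 = 2 * m - 2" "(-1) ^ (n + 1) = ((-1) ^ m :: real)" "real n = real m + 1"
    using n by simp_all
  have pw: "real p ^ (2 * m) * (1 / real p ^ 2) = real p ^ (2 * m - 2)" if "p > 1" for p
    using m that by (simp add: power_diff)
  show "(\<lambda>p. s p (4 * n + 1) - (-1)^(n + 1) * real p ^ (2 * n - 2))
      \<in> O[primes_at_top](\<lambda>p. real p ^ (2 * n - 4))"
    unfolding eqs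
    by (rule bigo_primes_scale[OF conjunct1[OF S] _ pw]) (auto simp: field_simps)
  show "(\<lambda>p. s p (4 * n + 3) - (-1)^(n + 1) * real n * E * real p ^ (2 * n - 2))
      \<in> O[primes_at_top](\<lambda>p. real p ^ (2 * n - 4))"
    unfolding eqs
    by (rule bigo_primes_scale[OF conjunct2[OF S] _ pw]) (auto simp: field_simps)
qed

end
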